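(* If $s\in\mathbb{R}$ and $m_s:\mathcal{S}(\mathbb{R}_+)\to\mathbb{R}$ is given by $$m_s(f):=\int_0^\infty x^{s-1}f(x)\,dx,$$ then $m_s\in\Delta(\mathcal{S}(\mathbb{R}_+),\star)$. Furthermore, for every $m\in\Delta(\mathcal{S}(\mathbb{R}_+),\star)$ there exists a unique $s\in\mathbb{R}$ such that $m=m_s$.
   Context: $\mathbb{R}_+=(0,\infty)$, $\mathbb{N}_0=\{0,1,2,\ldots\}$. $\mathcal{S}(\mathbb{R}_+)$ is the real vector space of all $f\in C^\infty(\mathbb{R}_+)$ (real-valued) such that for all $\alpha\in\mathbb{Z}$ and $\beta\in\mathbb{N}_0$ one has $p_{\alpha,\beta}(f) := \sup_{x\in\mathbb{R}_+} |x^\alpha f^{(\beta)}(x)| < \infty$, with the locally convex topology generated by the seminorms $(p_{\alpha,\beta})_{\alpha\in\mathbb{Z},\beta\in\mathbb{N}_0}$. The Mellin convolution of $f,g\in\mathcal{S}(\mathbb{R}_+)$ is the element $f\star g\in\mathcal{S}(\mathbb{R}_+)$ given by $f\star g(x):=\int_0^\infty y^{-1}f(xy^{-1})g(y)\,dy$. The structure space $\Delta(\mathcal{S}(\mathbb{R}_+),\star)$ is the set of all nonzero, linear, continuous functionals $m:\mathcal{S}(\mathbb{R}_+)\to\mathbb{R}$ which are multiplicative: $m(f\star g)=m(f)m(g)$ for all $f,g\in\mathcal{S}(\mathbb{R}_+)$. *)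

theory Defs
  imports "HOL-Analysis.Analysis"
begin

(* A function on the positive half-line is represented by its extension by 0 to all of real, so
   that equality of representatives is equality of functions on {0<..}, and pointwise
   linear operations act on representatives.  At a point x > 0 the iterated derivative of a
   representative depends only on its values on {0<..}. *)

definition schwartz_seminorm :: "int \<Rightarrow> nat \<Rightarrow> (real \<Rightarrow> real) \<Rightarrow> real" where
  "schwartz_seminorm \<alpha> \<beta> f = (SUP x\<in>{0<..}. \<bar>x powi \<alpha> * (deriv ^^ \<beta>) f x\<bar>)"

(* The supremum of an unbounded set of reals is unspecified, so its finiteness is
   expressed by bdd_above. *)
definition schwartz_pos :: "(real \<Rightarrow> real) set" where
  "schwartz_pos = {f. (\<forall>x\<le>0. f x = 0) \<and>
     (\<forall>n. \<forall>x>0. (deriv ^^ n) f differentiable (at x)) \<and>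
     (\<forall>\<alpha> \<beta>. bdd_above ((\<lambda>x. \<bar>x powi \<alpha> * (deriv ^^ \<beta>) f x\<bar>) ` {0<..}))}"

(* The locally convex topology of the family of seminorms: the open seminorm balls around
   all points form a subbase. *)
definition schwartz_topology :: "(real \<Rightarrow> real) topology" where
  "schwartz_topology = topology_generated_by
     {{g \<in> schwartz_pos. schwartz_seminorm \<alpha> \<beta> (\<lambda>x. g x - f x) < e} | f \<alpha> \<beta> e.
        f \<in> schwartz_pos \<and> 0 < e}"

definition mellin_conv :: "(real \<Rightarrow> real) \<Rightarrow> (real \<Rightarrow> real) \<Rightarrow> real \<Rightarrow> real" (infixl "\<star>" 70) where
  "f \<star> g = (\<lambda>x. if 0 < x then (LBINT y:{0<..}. inverse y * f (x * inverse y) * g y) else 0)"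

(* Functionals are extensional (fixed to undefined outside schwartz_pos), so that their
   equality is equality on schwartz_pos. *)
definition structure_space :: "((real \<Rightarrow> real) \<Rightarrow> real) set" where
  "structure_space = {m \<in> extensional schwartz_pos.
     (\<exists>f\<in>schwartz_pos. m f \<noteq> 0) \<and>
     (\<forall>f\<in>schwartz_pos. \<forall>g\<in>schwartz_pos. m (\<lambda>x. f x + g x) = m f + m g) \<and>
     (\<forall>c. \<forall>f\<in>schwartz_pos. m (\<lambda>x. c * f x) = c * m f) \<and>
     continuous_map schwartz_topology euclideanreal m \<and>
     (\<forall>f\<in>schwartz_pos. \<forall>g\<in>schwartz_pos. m (f \<star> g) = m f * m g)}"

definition mellin_functional :: "real \<Rightarrow> (real \<Rightarrow> real) \<Rightarrow> real" where
  "mellin_functional s = (\<lambda>f\<in>schwartz_pos. LBINT x:{0<..}. x powr (s - 1) * f x)"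

end

theory Submission
  imports Defs "HOL-Probability.Sinc_Integral"
begin

text \<open>
  The proof reduces everything to the Euler operator \<open>D f = x f'\<close>, the generator of the dilations of the
  half-line. Since the Mellin convolution is the convolution of the multiplicative group, \<open>D\<close> may be
  moved from one factor to the other: \<open>D f \<star> g = f \<star> D g\<close> (\<open>mellin_conv_euler_op\<close>, an integration by
  parts). Hence a multiplicative functional \<open>m\<close> with \<open>m g \<noteq> 0\<close> satisfies
  \<open>m (D f) m g = m f m (D g)\<close>, that is, \<open>m (D f) = - s m f\<close> for all \<open>f\<close>, where
  \<open>s = - m (D g) / m g\<close>. So \<open>m\<close> vanishes on every function of the form \<open>D u + s u\<close>.

  These functions are exactly the kernel of \<open>m\<^sub>s\<close>. The inclusion that matters is \<open>mellin_kernel\<close>: if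
  \<open>m\<^sub>s h = 0\<close>, then the equation \<open>D u + s u = h\<close>, which reads \<open>(x\<^sup>s u)' = x\<^bsup>s-1\<^esup> h\<close>, is solved by
  \<open>x\<^sup>s u = \<integral>\<^sub>0\<^sup>x y\<^bsup>s-1\<^esup> h(y) dy\<close>. The vanishing of the total integral is what makes \<open>u\<close> decay at infinity
  as well as at the origin. Two linear functionals, one vanishing on the kernel of the other, are
  proportional, and multiplicativity of both forces the factor to be 1. The parameter is unique
  because \<open>m\<^sub>s (D f) = - s m\<^sub>s f\<close> recovers \<open>s\<close> from \<open>m\<^sub>s\<close>.

  Conversely, \<open>m\<^sub>s\<close> is multiplicative by Fubini's theorem, it is continuous because
  \<open>x\<^bsup>s-1\<^esup>\<close> is bounded by two integral powers of \<open>x\<close> times the integrable weight \<open>1 / (1 + x\<^sup>2)\<close>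
  (\<open>powr_le_sum_powi\<close>), and it does not vanish on the positive function \<open>exp (- x - 1/x)\<close>. The space
  is closed under convolution because, after writing \<open>f \<star> g\<close> as an average of dilations of \<open>f\<close>,
  its derivative is an average of the same kind.
\<close>

section \<open>Rapidly decreasing functions on the half-line\<close>

text \<open>
  Real exponents are used here, so that the class is visibly stable under multiplication by the real
  powers in the Mellin transform; integral exponents give the same class
  (\<open>rapidly_decreasing_iff_powi\<close>).
\<close>

definition rapidly_decreasing :: "(real \<Rightarrow> real) \<Rightarrow> bool" where
  "rapidly_decreasing f \<longleftrightarrow> (\<forall>x\<le>0. f x = 0) \<and> (\<forall>a::real. \<exists>C. \<forall>x. \<bar>x powr a * f x\<bar> \<le> C)"

text \<open>
  Near the origin the smaller integral exponent dominates; for \<open>x \<ge> 1\<close> the exponent is raised by 2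
  to pay for the weight. The bound serves twice: it passes from integral to real exponents, and it
  makes \<open>x powr a * f x\<close> integrable with norm controlled by two of the defining seminorms.
\<close>

lemma powr_le_sum_powi:
  fixes x a :: real
  assumes "0 < x"
  shows "x powr a \<le> 2 * (x powi \<lfloor>a\<rfloor> + x powi \<lceil>a + 2\<rceil>) * inverse (1 + x\<^sup>2)"
proof -
  have "x powr a * (1 + x\<^sup>2) \<le> 2 * (x powi \<lfloor>a\<rfloor> + x powi \<lceil>a + 2\<rceil>)"
  proof (cases "x \<le> 1")
    case True
    have "x powr a \<le> x powr \<lfloor>a\<rfloor>"
      using assms True by (intro powr_mono') auto
    moreover have "1 + x\<^sup>2 \<le> 2"
      using assms True by (simp add: power_le_one)
    ultimately have "x powr a * (1 + x\<^sup>2) \<le> x powr \<lfloor>a\<rfloor> * 2"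
      by (intro mult_mono) auto
    then show ?thesis
      using assms by (simp add: powr_real_of_int' add_increasing2)
  next
    case False
    have "x powr a * (1 + x\<^sup>2) \<le> x powr a * (2 * x\<^sup>2)"
      using False by (intro mult_left_mono) auto
    also have "\<dots> = 2 * x powr (a + 2)"
      using assms by (simp add: powr_add powr_numeral)
    also have "\<dots> \<le> 2 * x powr \<lceil>a + 2\<rceil>"
      using False le_of_int_ceiling[of "a + 2"] by (intro mult_left_mono powr_mono) auto
    also have "\<dots> = 2 * x powi \<lceil>a + 2\<rceil>"
      using powr_real_of_int'[of x "\<lceil>a + 2\<rceil>"] assms by (metis less_eq_real_def less_irrefl)
    also have "\<dots> \<le> 2 * (x powi \<lfloor>a\<rfloor> + x powi \<lceil>a + 2\<rceil>)"
      using assms by simp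
    finally show ?thesis .
  qed
  moreover have "0 < 1 + x\<^sup>2"
    by (simp add: add_pos_nonneg)
  ultimately show ?thesis
    by (simp add: field_simps)
qed

lemma rapidly_decreasing_iff_powi:
  "rapidly_decreasing f \<longleftrightarrow>
     (\<forall>x\<le>0. f x = 0) \<and> (\<forall>k. bdd_above ((\<lambda>x. \<bar>x powi k * f x\<bar>) ` {0<..}))"
proof (intro iffI conjI allI)
  fix k :: int
  assume "rapidly_decreasing f"
  then obtain C where C: "\<And>x. \<bar>x powr (of_int k) * f x\<bar> \<le> C"
    unfolding rapidly_decreasing_def by blast
  have "\<bar>x powi k * f x\<bar> \<le> C" if "0 < x" for x
    using C[of x] that powr_real_of_int'[of x k] by simp
  then show "bdd_above ((\<lambda>x. \<bar>x powi k * f x\<bar>) ` {0<..})"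
    by (intro bdd_aboveI[of _ C]) auto
next
  assume *: "(\<forall>x\<le>0. f x = 0) \<and> (\<forall>k. bdd_above ((\<lambda>x. \<bar>x powi k * f x\<bar>) ` {0<..}))"
  have "\<exists>C. \<forall>x. \<bar>x powr a * f x\<bar> \<le> C" for a
  proof -
    have bound: "\<exists>C. \<forall>x>0. \<bar>x powi k * f x\<bar> \<le> C" for k
      using * by (simp add: bdd_above_def) (meson greaterThan_iff)
    obtain A where A: "\<And>x. 0 < x \<Longrightarrow> \<bar>x powi \<lfloor>a\<rfloor> * f x\<bar> \<le> A"
      using bound by blast
    obtain B where B: "\<And>x. 0 < x \<Longrightarrow> \<bar>x powi \<lceil>a + 2\<rceil> * f x\<bar> \<le> B"
      using bound by blast
    have "\<bar>x powr a * f x\<bar> \<le> 2 * (\<bar>A\<bar> + \<bar>B\<bar>)" for x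
    proof (cases "0 < x")
      case True
      have "x powr a \<le> 2 * (x powi \<lfloor>a\<rfloor> + x powi \<lceil>a + 2\<rceil>) * inverse (1 + x\<^sup>2)"
        using True by (rule powr_le_sum_powi)
      also have "\<dots> \<le> 2 * (x powi \<lfloor>a\<rfloor> + x powi \<lceil>a + 2\<rceil>)"
        using True by (intro mult_right_le_one_le) (auto simp: field_simps add_pos_nonneg)
      finally have "\<bar>x powr a * f x\<bar> \<le> 2 * (x powi \<lfloor>a\<rfloor> + x powi \<lceil>a + 2\<rceil>) * \<bar>f x\<bar>"
        by (simp add: abs_mult mult_right_mono)
      also have "\<dots> = 2 * (\<bar>x powi \<lfloor>a\<rfloor> * f x\<bar> + \<bar>x powi \<lceil>a + 2\<rceil> * f x\<bar>)"
        using True by (simp add: abs_mult algebra_simps)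
      also have "\<dots> \<le> 2 * (\<bar>A\<bar> + \<bar>B\<bar>)"
        by (intro mult_left_mono add_mono order_trans[OF A[OF True] abs_ge_self]
            order_trans[OF B[OF True] abs_ge_self]) simp
      finally show ?thesis .
    qed (use * in auto)
    then show ?thesis by blast
  qed
  then show "rapidly_decreasing f"
    using * unfolding rapidly_decreasing_def by blast
qed (auto simp: rapidly_decreasing_def)

lemma rapidly_decreasing_zero: "rapidly_decreasing f \<Longrightarrow> x \<le> 0 \<Longrightarrow> f x = 0"
  by (simp add: rapidly_decreasing_def)

lemma rapidly_decreasing_bound:
  assumes "rapidly_decreasing f"
  obtains C where "0 \<le> C" "\<And>x. \<bar>x powr a * f x\<bar> \<le> C"
proof -
  obtain C where "\<And>x. \<bar>x powr a * f x\<bar> \<le> C"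
    using assms unfolding rapidly_decreasing_def by blast
  then show thesis
    using that[of C] abs_ge_zero order_trans by blast
qed

lemma rapidly_decreasing_bounded:
  assumes "rapidly_decreasing f"
  obtains C where "0 \<le> C" "\<And>x. \<bar>f x\<bar> \<le> C"
proof -
  obtain C where C: "0 \<le> C" "\<And>x. \<bar>x powr 0 * f x\<bar> \<le> C"
    using rapidly_decreasing_bound[OF assms] by blast
  have "\<bar>f x\<bar> \<le> C" for x
    using C(1) C(2)[of x] rapidly_decreasing_zero[OF assms, of x] by (cases "x = 0") auto
  then show thesis using that C(1) by blast
qed

lemma rapidly_decreasing_add:
  assumes "rapidly_decreasing f" "rapidly_decreasing g"
  shows "rapidly_decreasing (\<lambda>x. f x + g x)"
  unfolding rapidly_decreasing_def
proof (intro conjI allI)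
  fix a
  obtain C where C: "\<And>x. \<bar>x powr a * f x\<bar> \<le> C"
    using rapidly_decreasing_bound[OF assms(1)] by blast
  obtain D where D: "\<And>x. \<bar>x powr a * g x\<bar> \<le> D"
    using rapidly_decreasing_bound[OF assms(2)] by blast
  have "\<bar>x powr a * (f x + g x)\<bar> \<le> C + D" for x
    using C[of x] D[of x] by (simp add: distrib_left)
  then show "\<exists>C. \<forall>x. \<bar>x powr a * (f x + g x)\<bar> \<le> C" by blast
qed (use assms in \<open>auto simp: rapidly_decreasing_def\<close>)

lemma rapidly_decreasing_cmult:
  assumes "rapidly_decreasing f"
  shows "rapidly_decreasing (\<lambda>x. c * f x)"
  unfolding rapidly_decreasing_def
proof (intro conjI allI)
  fix a
  obtain C where C: "\<And>x. \<bar>x powr a * f x\<bar> \<le> C"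
    using rapidly_decreasing_bound[OF assms] by blast
  have "\<bar>x powr a * (c * f x)\<bar> \<le> \<bar>c\<bar> * C" for x
    using mult_left_mono[OF C[of x], of "\<bar>c\<bar>"] by (simp add: abs_mult mult.left_commute)
  then show "\<exists>C. \<forall>x. \<bar>x powr a * (c * f x)\<bar> \<le> C" by blast
qed (use assms in \<open>auto simp: rapidly_decreasing_def\<close>)

lemma rapidly_decreasing_powr_mult:
  assumes "rapidly_decreasing f"
  shows "rapidly_decreasing (\<lambda>x. x powr b * f x)"
  unfolding rapidly_decreasing_def
proof (intro conjI allI)
  fix a
  obtain C where C: "\<And>x. \<bar>x powr (a + b) * f x\<bar> \<le> C"
    using rapidly_decreasing_bound[OF assms] by blast
  then show "\<exists>C. \<forall>x. \<bar>x powr a * (x powr b * f x)\<bar> \<le> C"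
    by (metis powr_add mult.assoc)
qed (use assms in \<open>auto simp: rapidly_decreasing_def\<close>)

lemma rapidly_decreasing_tendsto_0:
  assumes "rapidly_decreasing f"
  shows "(f \<longlongrightarrow> 0) (at_right 0)" "(f \<longlongrightarrow> 0) at_top"
proof -
  obtain C where C: "\<And>x. \<bar>x powr (-1) * f x\<bar> \<le> C"
    using rapidly_decreasing_bound[OF assms] by blast
  have "\<bar>f x\<bar> \<le> C * x" if "0 < x" for x
    using C[of x] that by (simp add: powr_minus abs_mult field_simps)
  then have "eventually (\<lambda>x. norm (f x) \<le> C * x) (at_right 0)"
    by (auto simp: eventually_at_filter)
  moreover have "((\<lambda>x. C * x) \<longlongrightarrow> 0) (at_right 0)"
    by (auto intro!: tendsto_eq_intros)
  ultimately show "(f \<longlongrightarrow> 0) (at_right 0)"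
    by (rule Lim_null_comparison)
  obtain B where B: "\<And>x. \<bar>x powr 1 * f x\<bar> \<le> B"
    using rapidly_decreasing_bound[OF assms] by blast
  have "\<bar>f x\<bar> \<le> B / x" if "0 < x" for x
    using B[of x] that by (simp add: abs_mult field_simps)
  then have "eventually (\<lambda>x. norm (f x) \<le> B / x) at_top"
    by (intro eventually_mono[OF eventually_gt_at_top[of 0]]) auto
  moreover have "((\<lambda>x. B / x) \<longlongrightarrow> 0) at_top"
    by (intro tendsto_divide_0[OF tendsto_const] filterlim_at_top_imp_at_infinity filterlim_ident)
  ultimately show "(f \<longlongrightarrow> 0) at_top"
    by (rule Lim_null_comparison)
qed

lemma integrable_inverse_1_plus_square_lborel:
  "integrable lborel (\<lambda>x::real. inverse (1 + x\<^sup>2))"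
  using integrable_inverse_1_plus_square by (simp add: set_integrable_def)

text \<open>
  The exponents 0 and 2 together bound \<open>f\<close> by a multiple of \<open>1 / (1 + x\<^sup>2)\<close>.
\<close>

lemma rapidly_decreasing_integrable:
  assumes f: "rapidly_decreasing f" and [measurable]: "f \<in> borel_measurable borel"
  shows "integrable lborel f"
proof -
  obtain A where A: "0 \<le> A" "\<And>x. \<bar>f x\<bar> \<le> A"
    using rapidly_decreasing_bounded[OF f] by blast
  obtain B where B: "0 \<le> B" "\<And>x. \<bar>x powr 2 * f x\<bar> \<le> B"
    using rapidly_decreasing_bound[OF f] by blast
  have "\<bar>f x\<bar> * (1 + x\<^sup>2) \<le> A + B" for x
  proof (cases "0 < x")
    case True
    then show ?thesis
      using A(2)[of x] B(2)[of x] by (simp add: powr_numeral abs_mult algebra_simps)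
  qed (use rapidly_decreasing_zero[OF f] A B in auto)
  then have le: "\<bar>f x\<bar> \<le> (A + B) * inverse (1 + x\<^sup>2)" for x
    by (simp add: field_simps add_pos_nonneg)
  show ?thesis
  proof (rule Bochner_Integration.integrable_bound)
    show "integrable lborel (\<lambda>x. (A + B) * inverse (1 + x\<^sup>2))"
      by (intro integrable_mult_right integrable_inverse_1_plus_square_lborel)
    show "AE x in lborel. norm (f x) \<le> norm ((A + B) * inverse (1 + x\<^sup>2))"
      using le by (auto intro: order_trans[OF _ abs_ge_self])
  qed simp
qed

lemma integrable_bounded_mult:
  fixes f b :: "real \<Rightarrow> real"
  assumes f: "integrable lborel f" and [measurable]: "b \<in> borel_measurable borel"
    and b: "\<And>x. \<bar>b x\<bar> \<le> C"
  shows "integrable lborel (\<lambda>x. b x * f x)"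
proof (rule Bochner_Integration.integrable_bound)
  show "integrable lborel (\<lambda>x. C * f x)"
    using f by simp
  have "0 \<le> C" using b[of 0] by linarith
  then show "AE x in lborel. norm (b x * f x) \<le> norm (C * f x)"
    using b by (auto simp: abs_mult intro!: mult_right_mono)
qed (use borel_measurable_integrable[OF f] in measurable)

section \<open>The Schwartz space through truncated derivatives\<close>

text \<open>
  Extending the derivative by 0 keeps it inside the class of functions that vanish off the half-line.
\<close>

definition pos_deriv :: "(real \<Rightarrow> real) \<Rightarrow> real \<Rightarrow> real" where
  "pos_deriv f x = (if 0 < x then deriv f x else 0)"

text \<open>
  Peeling off one derivative at a time lets closure properties of the Schwartz space be proved by
  induction on the number of controlled derivatives, in particular when the derivative of a function
  is expressed through the function itself.
\<close>

primrec schwartz_upto :: "nat \<Rightarrow> (real \<Rightarrow> real) \<Rightarrow> bool" where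
  "schwartz_upto 0 f \<longleftrightarrow> rapidly_decreasing f \<and> (\<forall>x>0. f differentiable (at x))"
| "schwartz_upto (Suc n) f \<longleftrightarrow>
     rapidly_decreasing f \<and> (\<forall>x>0. f differentiable (at x)) \<and> schwartz_upto n (pos_deriv f)"

lemma has_pos_deriv:
  "f differentiable (at x) \<Longrightarrow> 0 < x \<Longrightarrow> (f has_real_derivative pos_deriv f x) (at x)"
  by (simp add: pos_deriv_def DERIV_deriv_iff_real_differentiable)

lemma pos_deriv_eqI:
  assumes "\<And>x. 0 < x \<Longrightarrow> (f has_real_derivative f' x) (at x)" "\<And>x. x \<le> 0 \<Longrightarrow> f' x = 0"
  shows "pos_deriv f = f'"
  using assms by (auto simp: pos_deriv_def fun_eq_iff not_less intro: DERIV_imp_deriv)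

lemma deriv_cong_pos:
  fixes f g :: "real \<Rightarrow> real"
  assumes "\<And>x. 0 < x \<Longrightarrow> f x = g x" "0 < x"
  shows "deriv f x = deriv g x" "f differentiable (at x) \<longleftrightarrow> g differentiable (at x)"
proof -
  have ev: "eventually (\<lambda>y. f y = g y) (nhds x)"
    using assms by (intro eventually_mono[OF eventually_nhds_in_open[of "{0<..}"]]) auto
  then show "deriv f x = deriv g x"
    by (rule deriv_cong_ev) simp
  show "f differentiable (at x) \<longleftrightarrow> g differentiable (at x)"
    using DERIV_cong_ev[OF refl ev refl] by (simp add: real_differentiable_def)
qed

lemma funpow_pos_deriv: "0 < x \<Longrightarrow> (pos_deriv ^^ n) f x = (deriv ^^ n) f x"
proof (induction n arbitrary: x)
  case (Suc n)
  have "(pos_deriv ^^ Suc n) f x = deriv ((pos_deriv ^^ n) f) x"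
    using Suc.prems by (simp add: pos_deriv_def)
  also have "\<dots> = deriv ((deriv ^^ n) f) x"
    using Suc by (intro deriv_cong_pos(1)) auto
  finally show ?case by simp
qed simp

lemma schwartz_upto_iff: "schwartz_upto n f \<longleftrightarrow> (\<forall>i\<le>n. schwartz_upto 0 ((pos_deriv ^^ i) f))"
proof (induction n arbitrary: f)
  case (Suc n)
  have "(\<forall>i\<le>Suc n. schwartz_upto 0 ((pos_deriv ^^ i) f)) \<longleftrightarrow>
      schwartz_upto 0 f \<and> (\<forall>i\<le>n. schwartz_upto 0 ((pos_deriv ^^ Suc i) f))"
    by (metis Suc_le_mono funpow_0 le0 not0_implies_Suc)
  then show ?case
    using Suc.IH[of "pos_deriv f"]
    by (simp only: schwartz_upto.simps funpow_Suc_right o_apply conj_assoc)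
qed auto

lemma schwartz_pos_iff: "f \<in> schwartz_pos \<longleftrightarrow> (\<forall>n. schwartz_upto n f)"
proof -
  let ?P = "\<lambda>n. pos_deriv ^^ n"
  have vanish: "(\<forall>x\<le>0. f x = 0) \<longleftrightarrow> (\<forall>n. \<forall>x\<le>0. ?P n f x = 0)"
  proof
    assume "\<forall>x\<le>0. f x = 0"
    then have "?P n f x = 0" if "x \<le> 0" for n x
      using that by (cases n) (auto simp: pos_deriv_def)
    then show "\<forall>n. \<forall>x\<le>0. ?P n f x = 0" by blast
  qed (metis funpow_0)
  have diff: "?P n f differentiable (at x) \<longleftrightarrow> (deriv ^^ n) f differentiable (at x)"
    if "0 < x" for n x
    using that by (intro deriv_cong_pos(2)) (auto simp: funpow_pos_deriv)
  have "(\<forall>n. schwartz_upto n f) \<longleftrightarrow> (\<forall>n. schwartz_upto 0 (?P n f))"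
    by (meson schwartz_upto_iff order_refl)
  also have "\<dots> \<longleftrightarrow> f \<in> schwartz_pos"
    using vanish diff unfolding schwartz_pos_def
    by (auto simp: rapidly_decreasing_iff_powi funpow_pos_deriv cong: image_cong_simp)
  finally show ?thesis ..
qed

lemma schwartz_upto_add:
  "schwartz_upto n f \<Longrightarrow> schwartz_upto n g \<Longrightarrow> schwartz_upto n (\<lambda>x. f x + g x)"
proof (induction n arbitrary: f g)
  case 0
  then show ?case
    by (simp add: rapidly_decreasing_add differentiable_add)
next
  case (Suc n)
  have "pos_deriv (\<lambda>x. f x + g x) = (\<lambda>x. pos_deriv f x + pos_deriv g x)"
    using Suc.prems
    by (intro pos_deriv_eqI DERIV_add has_pos_deriv) (simp_all add: pos_deriv_def)
  then show ?case
    using Suc by (simp add: rapidly_decreasing_add differentiable_add)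
qed

lemma schwartz_upto_cmult: "schwartz_upto n f \<Longrightarrow> schwartz_upto n (\<lambda>x. c * f x)"
proof (induction n arbitrary: f)
  case 0
  then show ?case
    by (simp add: rapidly_decreasing_cmult differentiable_mult)
next
  case (Suc n)
  have "pos_deriv (\<lambda>x. c * f x) = (\<lambda>x. c * pos_deriv f x)"
    using Suc.prems
    by (intro pos_deriv_eqI DERIV_cmult has_pos_deriv) (simp_all add: pos_deriv_def)
  then show ?case
    using Suc by (simp add: rapidly_decreasing_cmult differentiable_mult)
qed

lemma powr_differentiable: "0 < x \<Longrightarrow> (\<lambda>x::real. x powr a) differentiable (at x)"
  unfolding real_differentiable_def by (auto intro!: derivative_eq_intros)

lemma schwartz_upto_powr_mult: "schwartz_upto n f \<Longrightarrow> schwartz_upto n (\<lambda>x. x powr a * f x)"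
proof (induction n arbitrary: f a)
  case 0
  then show ?case
    by (simp add: rapidly_decreasing_powr_mult differentiable_mult powr_differentiable)
next
  case (Suc n)
  have "pos_deriv (\<lambda>x. x powr a * f x) =
      (\<lambda>x. a * (x powr (a - 1) * f x) + x powr a * pos_deriv f x)"
  proof (rule pos_deriv_eqI)
    fix x :: real
    assume x: "0 < x"
    have "((\<lambda>x. x powr a) has_real_derivative a * x powr (a - 1)) (at x)"
      using x by (auto intro!: derivative_eq_intros)
    moreover have "(f has_real_derivative pos_deriv f x) (at x)"
      using Suc.prems x by (auto intro: has_pos_deriv)
    ultimately show "((\<lambda>x. x powr a * f x) has_real_derivative
        a * (x powr (a - 1) * f x) + x powr a * pos_deriv f x) (at x)"
      by (rule DERIV_cong[OF DERIV_mult]) (simp add: mult_ac)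
  qed (use Suc.prems in \<open>auto simp: pos_deriv_def[of _ "_::real"] rapidly_decreasing_zero\<close>)
  moreover have "schwartz_upto n f"
    using Suc.prems unfolding schwartz_upto_iff[of "Suc n"] schwartz_upto_iff[of n] by simp
  ultimately have "schwartz_upto n (pos_deriv (\<lambda>x. x powr a * f x))"
    using Suc.prems by (auto intro!: schwartz_upto_add schwartz_upto_cmult Suc.IH)
  moreover have "schwartz_upto 0 (\<lambda>x. x powr a * f x)"
    using Suc.prems by (simp add: rapidly_decreasing_powr_mult differentiable_mult powr_differentiable)
  ultimately show ?case by simp
qed

lemma schwartz_pos_add: "f \<in> schwartz_pos \<Longrightarrow> g \<in> schwartz_pos \<Longrightarrow> (\<lambda>x. f x + g x) \<in> schwartz_pos"
  by (simp add: schwartz_pos_iff schwartz_upto_add)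

lemma schwartz_pos_cmult: "f \<in> schwartz_pos \<Longrightarrow> (\<lambda>x. c * f x) \<in> schwartz_pos"
  by (simp add: schwartz_pos_iff schwartz_upto_cmult)

lemma schwartz_pos_diff: "f \<in> schwartz_pos \<Longrightarrow> g \<in> schwartz_pos \<Longrightarrow> (\<lambda>x. f x - g x) \<in> schwartz_pos"
  using schwartz_pos_add[of f "\<lambda>x. (-1) * g x"] schwartz_pos_cmult[of g "-1"] by simp

lemma schwartz_pos_powr_mult: "f \<in> schwartz_pos \<Longrightarrow> (\<lambda>x. x powr a * f x) \<in> schwartz_pos"
  by (simp add: schwartz_pos_iff schwartz_upto_powr_mult)

lemma schwartz_pos_pos_deriv: "f \<in> schwartz_pos \<Longrightarrow> pos_deriv f \<in> schwartz_pos"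
  by (metis schwartz_pos_iff schwartz_upto.simps(2))

lemma schwartz_pos_rapidly_decreasing: "f \<in> schwartz_pos \<Longrightarrow> rapidly_decreasing f"
  by (metis schwartz_pos_iff schwartz_upto.simps(1))

lemma schwartz_pos_zero: "f \<in> schwartz_pos \<Longrightarrow> x \<le> 0 \<Longrightarrow> f x = 0"
  by (simp add: schwartz_pos_def)

lemma schwartz_pos_DERIV:
  "f \<in> schwartz_pos \<Longrightarrow> 0 < x \<Longrightarrow> (f has_real_derivative pos_deriv f x) (at x)"
  by (metis has_pos_deriv schwartz_pos_iff schwartz_upto.simps(1))

lemma schwartz_pos_isCont: "f \<in> schwartz_pos \<Longrightarrow> 0 < x \<Longrightarrow> isCont f x"
  using schwartz_pos_DERIV DERIV_isCont by blast

lemma schwartz_pos_measurable: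
  assumes "f \<in> schwartz_pos"
  shows "f \<in> borel_measurable borel"
proof -
  have "continuous_on {0<..} f"
    using assms by (auto intro!: continuous_at_imp_continuous_on schwartz_pos_isCont)
  then have "(\<lambda>x. indicator {0<..} x *\<^sub>R f x) \<in> borel_measurable borel"
    by (intro borel_measurable_continuous_on_indicator) auto
  also have "(\<lambda>x. indicator {0<..} x *\<^sub>R f x) = f"
    using assms by (auto simp: fun_eq_iff indicator_def schwartz_pos_zero not_less)
  finally show ?thesis .
qed

lemma schwartz_pos_integrable: "f \<in> schwartz_pos \<Longrightarrow> integrable lborel f"
  by (simp add: rapidly_decreasing_integrable schwartz_pos_rapidly_decreasing schwartz_pos_measurable)

text \<open>
  The Schwartz space is the largest set of rapidly decreasing functions that is closed under
  differentiation.
\<close>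

lemma schwartz_pos_coinduct:
  assumes "P f"
    and "\<And>f. P f \<Longrightarrow> rapidly_decreasing f"
    and "\<And>f. P f \<Longrightarrow> \<exists>f'. P f' \<and> (\<forall>x>0. (f has_real_derivative f' x) (at x))"
  shows "f \<in> schwartz_pos"
proof -
  have "schwartz_upto n f" if "P f" for n f
    using that
  proof (induction n arbitrary: f)
    case 0
    then show ?case
      using assms(2,3) by (auto simp: real_differentiable_def) blast
  next
    case (Suc n)
    obtain f' where f': "P f'" "\<And>x. 0 < x \<Longrightarrow> (f has_real_derivative f' x) (at x)"
      using assms(3)[OF Suc.prems] by blast
    then have "pos_deriv f = f'"
      using assms(2) by (intro pos_deriv_eqI) (auto simp: rapidly_decreasing_zero)
    then show ?case
      using f' assms(2)[OF Suc.prems] Suc.IH by (auto simp: real_differentiable_def)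
  qed
  then show ?thesis
    using assms(1) by (simp add: schwartz_pos_iff)
qed

section \<open>Integration by parts and averages over dilations\<close>

lemma integral_derivative_eq_0:
  fixes F F' :: "real \<Rightarrow> real"
  assumes "\<And>x. 0 < x \<Longrightarrow> (F has_real_derivative F' x) (at x)"
    and "\<And>x. 0 < x \<Longrightarrow> isCont F' x" "\<And>x. x \<le> 0 \<Longrightarrow> F' x = 0"
    and F': "integrable lborel F'" and F: "(F \<longlongrightarrow> 0) (at_right 0)" "(F \<longlongrightarrow> 0) at_top"
  shows "integral\<^sup>L lborel F' = 0"
proof -
  have E: "einterval 0 \<infinity> = {0<..}"
    by (auto simp: einterval_def zero_ereal_def)
  have "(LBINT x=0..\<infinity>. F' x) = 0 - 0"
  proof (rule interval_integral_FTC_integrable)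
    show "set_integrable lborel (einterval 0 \<infinity>) F'"
      unfolding E set_integrable_def using F' by (intro integrable_mult_indicator) auto
    show "((F \<circ> real_of_ereal) \<longlongrightarrow> 0) (at_right 0)"
      using F(1) by (simp add: zero_ereal_def ereal_tendsto_simps)
    show "((F \<circ> real_of_ereal) \<longlongrightarrow> 0) (at_left \<infinity>)"
      using F(2) by (simp add: ereal_tendsto_simps)
  qed (use assms in \<open>auto simp: has_real_derivative_iff_has_vector_derivative\<close>)
  moreover have "(LBINT x=0..\<infinity>. F' x) = integral\<^sup>L lborel F'"
    unfolding interval_lebesgue_integral_def E set_lebesgue_integral_def
    using assms(3) by (auto intro!: Bochner_Integration.integral_cong simp: indicator_def not_less)
  ultimately show ?thesis by simp
qed

text \<open>
  Differentiation under the integral sign: the mean value theorem bounds the difference quotients by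
  the same \<open>w\<close> as the derivatives, and dominated convergence applies.
\<close>

lemma has_real_derivative_integral:
  fixes F F' :: "real \<Rightarrow> real \<Rightarrow> real"
  assumes F: "\<And>x y. 0 < x \<Longrightarrow> ((\<lambda>x. F x y) has_real_derivative F' x y) (at x)"
    and int: "\<And>x. 0 < x \<Longrightarrow> integrable lborel (F x)"
    and F': "\<And>x. 0 < x \<Longrightarrow> F' x \<in> borel_measurable borel"
    and w: "\<And>x y. 0 < x \<Longrightarrow> \<bar>F' x y\<bar> \<le> w y" "integrable lborel w"
    and x: "0 < x"
  shows "((\<lambda>x. integral\<^sup>L lborel (F x)) has_real_derivative integral\<^sup>L lborel (F' x)) (at x)"
proof -
  let ?G = "\<lambda>x. integral\<^sup>L lborel (F x)"
  have "((\<lambda>z. (?G z - ?G x) / (z - x)) \<longlongrightarrow> integral\<^sup>L lborel (F' x)) (at x within {0<..})"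
    unfolding tendsto_at_iff_sequentially
  proof (intro allI impI)
    fix X :: "nat \<Rightarrow> real"
    assume X: "\<forall>i. X i \<in> {0<..} - {x}" and lim: "X \<longlonglongrightarrow> x"
    have Xpos: "0 < X i" and Xne: "X i \<noteq> x" for i
      using X by auto
    let ?q = "\<lambda>i y. (F (X i) y - F x y) / (X i - x)"
    have "(\<lambda>i. integral\<^sup>L lborel (?q i)) \<longlonglongrightarrow> integral\<^sup>L lborel (F' x)"
    proof (rule integral_dominated_convergence)
      show "F' x \<in> borel_measurable lborel"
        using F' x by simp
      show "?q i \<in> borel_measurable lborel" for i
        using borel_measurable_integrable[OF int[OF Xpos]] borel_measurable_integrable[OF int[OF x]]
        by measurable
      show "integrable lborel w" by (rule w)
      have "(\<lambda>i. ?q i y) \<longlonglongrightarrow> F' x y" for y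
      proof -
        have "((\<lambda>z. (F z y - F x y) / (z - x)) \<longlongrightarrow> F' x y) (at x)"
          using F[OF x, of y] by (simp add: has_field_derivative_iff)
        moreover have "filterlim X (at x) sequentially"
          using lim Xne by (simp add: filterlim_at)
        ultimately show ?thesis by (rule filterlim_compose)
      qed
      then show "AE y in lborel. (\<lambda>i. ?q i y) \<longlonglongrightarrow> F' x y" by simp
      have "norm (?q i y) \<le> w y" for i y
      proof -
        have "norm (F (X i) y - F x y) \<le> w y * norm (X i - x)"
          using F w(1) x Xpos
          by (intro field_differentiable_bound[where S="{0<..}" and f'="\<lambda>x. F' x y"])
            (auto intro: DERIV_subset)
        then show ?thesis
          using Xne[of i] by (simp add: field_simps)
      qed
      then show "AE y in lborel. norm (?q i y) \<le> w y" for i by simp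
    qed
    moreover have "integral\<^sup>L lborel (?q i) = (?G (X i) - ?G x) / (X i - x)" for i
      by (simp only: integral_divide_zero Bochner_Integration.integral_diff[OF int[OF Xpos] int[OF x]])
    ultimately show "((\<lambda>z. (?G z - ?G x) / (z - x)) \<circ> X) \<longlonglongrightarrow> integral\<^sup>L lborel (F' x)"
      by (simp only: o_def)
  qed
  then show ?thesis
    using x by (simp add: has_field_derivative_iff at_within_open[of x "{0<..}"])
qed

text \<open>
  The Mellin convolution with the factor \<open>1 / y\<close> absorbed into the second function. Powers of the
  variable and derivatives act on this form by changing the two arguments only
  (\<open>powr_mult_dilation_average\<close>, \<open>dilation_average_DERIV\<close>). Since the arguments vanish off the half-line,
  the integral can be taken over the whole line.
\<close>

definition dilation_average :: "(real \<Rightarrow> real) \<Rightarrow> (real \<Rightarrow> real) \<Rightarrow> real \<Rightarrow> real" where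
  "dilation_average f k x = (\<integral>y. f (x / y) * k y \<partial>lborel)"

lemma mellin_conv_eq_dilation_average:
  assumes "f \<in> schwartz_pos" "g \<in> schwartz_pos"
  shows "f \<star> g = dilation_average f (\<lambda>y. y powr -1 * g y)"
proof
  fix x
  show "(f \<star> g) x = dilation_average f (\<lambda>y. y powr -1 * g y) x"
  proof (cases "0 < x")
    case True
    then have "(f \<star> g) x = (\<integral>y. indicator {0<..} y *\<^sub>R (inverse y * f (x * inverse y) * g y) \<partial>lborel)"
      by (simp add: mellin_conv_def set_lebesgue_integral_def)
    also have "\<dots> = dilation_average f (\<lambda>y. y powr -1 * g y) x"
      unfolding dilation_average_def
      by (intro Bochner_Integration.integral_cong refl)
        (auto simp: indicator_def not_less schwartz_pos_zero[OF assms(2)] powr_minus divide_inverse)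
    finally show ?thesis .
  next
    case False
    have "f (x / y) * (y powr -1 * g y) = 0" for y
      using False schwartz_pos_zero[OF assms(1), of "x / y"] schwartz_pos_zero[OF assms(2), of y]
      by (cases "0 < y") (auto simp: divide_le_0_iff)
    then show ?thesis
      using False by (simp only: mellin_conv_def dilation_average_def) simp
  qed
qed

lemma dilation_average_integrable:
  assumes "f \<in> schwartz_pos" "k \<in> schwartz_pos"
  shows "integrable lborel (\<lambda>y. f (x / y) * k y)"
proof -
  note [measurable] = schwartz_pos_measurable[OF assms(1)]
  obtain C where "\<And>u. \<bar>f u\<bar> \<le> C"
    using rapidly_decreasing_bounded[OF schwartz_pos_rapidly_decreasing[OF assms(1)]] by blast
  then show ?thesis
    by (intro integrable_bounded_mult schwartz_pos_integrable assms(2)) measurable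
qed

text \<open>
  The splitting \<open>x\<^sup>a = (x / y)\<^sup>a y\<^sup>a\<close> distributes a power over both arguments; thus rapid decrease of an
  average reduces to its boundedness, and the Mellin transform of one to its plain integral.
\<close>

lemma powr_mult_dilation_average:
  assumes "f \<in> schwartz_pos" "k \<in> schwartz_pos"
  shows "x powr a * dilation_average f k x =
    dilation_average (\<lambda>u. u powr a * f u) (\<lambda>y. y powr a * k y) x"
proof -
  have "x powr a * (f (x / y) * k y) = (x / y) powr a * f (x / y) * (y powr a * k y)" for y
  proof (cases "0 < x \<and> 0 < y")
    case True
    then show ?thesis by (simp add: powr_divide)
  next
    case False
    then have "k y = 0 \<or> f (x / y) = 0"
      using schwartz_pos_zero[OF assms(1), of "x / y"] schwartz_pos_zero[OF assms(2), of y]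
      by (cases "0 < y") (auto simp: divide_le_0_iff)
    then show ?thesis by auto
  qed
  then show ?thesis
    by (simp only: dilation_average_def flip: integral_mult_right_zero)
qed

lemma dilation_average_bounded:
  assumes "f \<in> schwartz_pos" "k \<in> schwartz_pos"
  shows "\<exists>C. \<forall>x. \<bar>dilation_average f k x\<bar> \<le> C"
proof -
  obtain C where C: "\<And>u. \<bar>f u\<bar> \<le> C"
    using rapidly_decreasing_bounded[OF schwartz_pos_rapidly_decreasing[OF assms(1)]] by blast
  have "\<bar>dilation_average f k x\<bar> \<le> (\<integral>y. C * \<bar>k y\<bar> \<partial>lborel)" for x
    unfolding dilation_average_def
  proof (rule order_trans[OF integral_abs_bound integral_mono])
    show "integrable lborel (\<lambda>y. \<bar>f (x / y) * k y\<bar>)"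
      using dilation_average_integrable[OF assms] by simp
    show "integrable lborel (\<lambda>y. C * \<bar>k y\<bar>)"
      using schwartz_pos_integrable[OF assms(2)] by simp
    show "\<bar>f (x / y) * k y\<bar> \<le> C * \<bar>k y\<bar>" for y
      using C by (simp add: abs_mult mult_right_mono)
  qed
  then show ?thesis by blast
qed

lemma dilation_average_eq_0:
  assumes "f \<in> schwartz_pos" "k \<in> schwartz_pos" "x \<le> 0"
  shows "dilation_average f k x = 0"
proof -
  have "f (x / y) * k y = 0" for y
    using assms(3) schwartz_pos_zero[OF assms(1), of "x / y"] schwartz_pos_zero[OF assms(2), of y]
    by (cases "0 < y") (auto simp: divide_le_0_iff)
  then show ?thesis by (simp only: dilation_average_def) simp
qed

lemma dilation_average_rapidly_decreasing:
  assumes "f \<in> schwartz_pos" "k \<in> schwartz_pos"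
  shows "rapidly_decreasing (dilation_average f k)"
  unfolding rapidly_decreasing_def powr_mult_dilation_average[OF assms]
  by (intro conjI allI impI dilation_average_bounded dilation_average_eq_0 schwartz_pos_powr_mult assms)

text \<open>
  Differentiating \<open>f (x / y)\<close> in \<open>x\<close> brings out a factor \<open>1 / y\<close>, and boundedness of \<open>f'\<close> makes the
  differentiated integrand dominated uniformly in \<open>x\<close>.
\<close>

lemma dilation_average_DERIV:
  assumes f: "f \<in> schwartz_pos" and k: "k \<in> schwartz_pos" and "0 < x"
  shows "(dilation_average f k has_real_derivative
    dilation_average (pos_deriv f) (\<lambda>y. y powr -1 * k y) x) (at x)"
proof -
  have f': "pos_deriv f \<in> schwartz_pos" and k': "(\<lambda>y. y powr -1 * k y) \<in> schwartz_pos"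
    by (rule schwartz_pos_pos_deriv[OF f], rule schwartz_pos_powr_mult[OF k])
  obtain C where C: "\<And>u. \<bar>pos_deriv f u\<bar> \<le> C"
    using rapidly_decreasing_bounded[OF schwartz_pos_rapidly_decreasing[OF f']] by blast
  have "((\<lambda>x. \<integral>y. f (x / y) * k y \<partial>lborel) has_real_derivative
      (\<integral>y. pos_deriv f (x / y) * (y powr -1 * k y) \<partial>lborel)) (at x)"
  proof (rule has_real_derivative_integral)
    fix x y :: real
    assume x: "0 < x"
    show "((\<lambda>x. f (x / y) * k y) has_real_derivative
        pos_deriv f (x / y) * (y powr -1 * k y)) (at x)"
    proof (cases "0 < y")
      case True
      have "((\<lambda>x. f (x / y)) has_real_derivative pos_deriv f (x / y) * (1 / y)) (at x)"
        using schwartz_pos_DERIV[OF f, of "x / y"] x True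
        by (intro DERIV_chain2[where g="\<lambda>x. x / y"]) (auto intro!: derivative_eq_intros)
      from DERIV_cmult_right[OF this, of "k y"] show ?thesis
        by (rule DERIV_cong) (use True in \<open>simp add: powr_minus divide_inverse\<close>)
    qed (simp add: schwartz_pos_zero[OF k])
    show "\<bar>pos_deriv f (x / y) * (y powr -1 * k y)\<bar> \<le> C * \<bar>y powr -1 * k y\<bar>"
      unfolding abs_mult[of "pos_deriv f (x / y)"] by (intro mult_right_mono C abs_ge_zero)
  next
    show "integrable lborel (\<lambda>y. f (x / y) * k y)" for x
      by (rule dilation_average_integrable[OF f k])
    show "(\<lambda>y. pos_deriv f (x / y) * (y powr -1 * k y)) \<in> borel_measurable borel" for x
      using borel_measurable_integrable[OF dilation_average_integrable[OF f' k']] by simp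
    show "integrable lborel (\<lambda>y. C * \<bar>y powr -1 * k y\<bar>)"
      by (intro integrable_mult_right integrable_abs schwartz_pos_integrable[OF k'])
  qed (rule \<open>0 < x\<close>)
  then show ?thesis
    by (simp add: dilation_average_def[abs_def])
qed

text \<open>
  Averages of Schwartz functions are rapidly decreasing and closed under differentiation.
\<close>

lemma dilation_average_schwartz:
  assumes "f \<in> schwartz_pos" "k \<in> schwartz_pos"
  shows "dilation_average f k \<in> schwartz_pos"
proof (rule schwartz_pos_coinduct)
  let ?P = "\<lambda>h. \<exists>f\<in>schwartz_pos. \<exists>k\<in>schwartz_pos. h = dilation_average f k"
  show "?P (dilation_average f k)" using assms by blast
  fix h
  assume "?P h"
  then obtain f k where h: "h = dilation_average f k" "f \<in> schwartz_pos" "k \<in> schwartz_pos"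
    by blast
  show "rapidly_decreasing h"
    using h by (simp add: dilation_average_rapidly_decreasing)
  show "\<exists>h'. ?P h' \<and> (\<forall>x>0. (h has_real_derivative h' x) (at x))"
  proof (intro exI conjI)
    show "?P (dilation_average (pos_deriv f) (\<lambda>y. y powr -1 * k y))"
      by (rule bexI[OF bexI[OF refl schwartz_pos_powr_mult[OF h(3)]] schwartz_pos_pos_deriv[OF h(2)]])
    show "\<forall>x>0. (h has_real_derivative
        dilation_average (pos_deriv f) (\<lambda>y. y powr -1 * k y) x) (at x)"
      unfolding h(1) by (intro allI impI dilation_average_DERIV h(2,3))
  qed
qed

lemma mellin_conv_schwartz:
  "f \<in> schwartz_pos \<Longrightarrow> g \<in> schwartz_pos \<Longrightarrow> f \<star> g \<in> schwartz_pos"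
  by (simp only: mellin_conv_eq_dilation_average dilation_average_schwartz schwartz_pos_powr_mult)

text \<open>
  Exchange the integrals; then dilating \<open>f\<close> by \<open>y\<close> multiplies its integral by \<open>y\<close>.
\<close>

lemma integral_dilation_average:
  assumes f: "f \<in> schwartz_pos" and k: "k \<in> schwartz_pos"
  shows "integral\<^sup>L lborel (dilation_average f k) =
    integral\<^sup>L lborel f * (\<integral>y. y powr 1 * k y \<partial>lborel)"
proof -
  note [measurable] = schwartz_pos_measurable[OF f] schwartz_pos_measurable[OF k]
  have scale: "(\<integral>x. h (x / y) \<partial>lborel) = y * integral\<^sup>L lborel h" if "0 < y"
    for y and h :: "real \<Rightarrow> real"
    using lborel_integral_real_affine[of "y" "\<lambda>x. h (x / y)" 0] that by simp
  \<comment> \<open>Stated for arbitrary \<open>h\<close> and \<open>l\<close>: it is needed for \<open>f\<close> and \<open>k\<close> and for their absolute values.\<close>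
  have eq: "(\<integral>x. h (x / y) * l y \<partial>lborel) = integral\<^sup>L lborel h * (y powr 1 * l y)"
    if "\<And>y. y \<le> 0 \<Longrightarrow> l y = 0" for y and h l :: "real \<Rightarrow> real"
    using scale[of y h] that[of y] by (cases "0 < y") auto
  have int: "integrable (lborel \<Otimes>\<^sub>M lborel) (\<lambda>(y, x). f (x / y) * k y)"
  proof (rule lborel_pair.Fubini_integrable)
    have "integrable lborel (\<lambda>y. y powr 1 * k y)"
      using k by (intro schwartz_pos_integrable schwartz_pos_powr_mult)
    then have "integrable lborel (\<lambda>y. (\<integral>x. \<bar>f x\<bar> \<partial>lborel) * \<bar>y powr 1 * k y\<bar>)"
      by (intro integrable_mult_right integrable_abs)
    also have "(\<lambda>y. (\<integral>x. \<bar>f x\<bar> \<partial>lborel) * \<bar>y powr 1 * k y\<bar>) =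
        (\<lambda>y. \<integral>x. norm (f (x / y) * k y) \<partial>lborel)"
    proof
      fix y
      have "(\<integral>x. norm (f (x / y) * k y) \<partial>lborel) = (\<integral>x. \<bar>f (x / y)\<bar> * \<bar>k y\<bar> \<partial>lborel)"
        by (simp only: real_norm_def abs_mult)
      also have "\<dots> = (\<integral>x. \<bar>f x\<bar> \<partial>lborel) * (y powr 1 * \<bar>k y\<bar>)"
        by (rule eq) (simp add: schwartz_pos_zero[OF k])
      finally show "(\<integral>x. \<bar>f x\<bar> \<partial>lborel) * \<bar>y powr 1 * k y\<bar> =
          (\<integral>x. norm (f (x / y) * k y) \<partial>lborel)"
        by (simp only: abs_mult abs_of_nonneg[OF powr_ge_zero])
    qed
    finally show "integrable lborel
        (\<lambda>y. \<integral>x. norm (case (y, x) of (y, x) \<Rightarrow> f (x / y) * k y) \<partial>lborel)"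
      by simp
    have "integrable lborel (\<lambda>x. f (x / y) * k y)" for y
    proof (cases "0 < y")
      case True
      then have "integrable lborel (\<lambda>x. f (0 + inverse y * x))"
        by (intro lborel_integrable_real_affine schwartz_pos_integrable f) auto
      then show ?thesis
        by (simp add: field_simps)
    qed (simp add: schwartz_pos_zero[OF k])
    then show "AE y in lborel. integrable lborel
        (\<lambda>x. case (y, x) of (y, x) \<Rightarrow> f (x / y) * k y)"
      by simp
  qed measurable
  have "integral\<^sup>L lborel (dilation_average f k) =
      (\<integral>x. (\<integral>y. f (x / y) * k y \<partial>lborel) \<partial>lborel)"
    by (simp add: dilation_average_def[abs_def])
  also have "\<dots> = (\<integral>y. (\<integral>x. f (x / y) * k y \<partial>lborel) \<partial>lborel)"
    by (rule lborel_pair.Fubini_integral[OF int])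
  also have "\<dots> = (\<integral>y. integral\<^sup>L lborel f * (y powr 1 * k y) \<partial>lborel)"
    by (intro Bochner_Integration.integral_cong refl eq schwartz_pos_zero[OF k])
  finally show ?thesis by simp
qed

section \<open>The Mellin transform and the Euler operator\<close>

text \<open>
  Unrestricted and over the whole line, so that it can be rewritten without side conditions; on the
  Schwartz space it agrees with the functional of the theorem.
\<close>

definition mellin :: "real \<Rightarrow> (real \<Rightarrow> real) \<Rightarrow> real" where
  "mellin s f = (\<integral>x. x powr (s - 1) * f x \<partial>lborel)"

lemma mellin_functional_eq: "f \<in> schwartz_pos \<Longrightarrow> mellin_functional s f = mellin s f"
  unfolding mellin_functional_def mellin_def set_lebesgue_integral_def restrict_apply
  by (auto intro!: Bochner_Integration.integral_cong
      simp: indicator_def not_less schwartz_pos_zero)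

lemma mellin_integrable:
  "f \<in> schwartz_pos \<Longrightarrow> integrable lborel (\<lambda>x. x powr (s - 1) * f x)"
  by (intro schwartz_pos_integrable schwartz_pos_powr_mult)

lemma mellin_add:
  "f \<in> schwartz_pos \<Longrightarrow> g \<in> schwartz_pos \<Longrightarrow> mellin s (\<lambda>x. f x + g x) = mellin s f + mellin s g"
  by (simp add: mellin_def distrib_left mellin_integrable)

lemma mellin_cmult: "mellin s (\<lambda>x. c * f x) = c * mellin s f"
  by (simp add: mellin_def mult.left_commute)

lemma mellin_diff:
  "f \<in> schwartz_pos \<Longrightarrow> g \<in> schwartz_pos \<Longrightarrow> mellin s (\<lambda>x. f x - g x) = mellin s f - mellin s g"
  by (simp add: mellin_def right_diff_distrib mellin_integrable)

text \<open>
  Pulling \<open>x\<^bsup>s-1\<^esup>\<close> into both arguments of the average reduces multiplicativity to the integral of an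
  average, where the factor \<open>y\<close> coming from the dilation cancels the \<open>1 / y\<close> of the convolution.
\<close>

lemma mellin_mellin_conv:
  assumes f: "f \<in> schwartz_pos" and g: "g \<in> schwartz_pos"
  shows "mellin s (f \<star> g) = mellin s f * mellin s g"
proof -
  let ?f = "\<lambda>x. x powr (s - 1) * f x" and ?k = "\<lambda>y. y powr (s - 1) * (y powr -1 * g y)"
  have "mellin s (f \<star> g) = integral\<^sup>L lborel (dilation_average ?f ?k)"
    unfolding mellin_def mellin_conv_eq_dilation_average[OF f g]
    by (simp only: powr_mult_dilation_average[OF f schwartz_pos_powr_mult[OF g]])
  also have "\<dots> = mellin s f * (\<integral>y. y powr 1 * ?k y \<partial>lborel)"
    unfolding mellin_def
    by (intro integral_dilation_average schwartz_pos_powr_mult f g)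
  also have "(\<lambda>y. y powr 1 * ?k y) = (\<lambda>y. y powr (s - 1) * g y)"
    by (simp only: mult.assoc[symmetric] powr_add[symmetric]) simp
  finally show ?thesis by (simp only: mellin_def)
qed

text \<open>
  The infinitesimal generator of the dilations \<open>f(x) \<mapsto> f(e\<^sup>t x)\<close>.
\<close>

definition euler_op :: "(real \<Rightarrow> real) \<Rightarrow> real \<Rightarrow> real" where
  "euler_op f x = x * pos_deriv f x"

lemma euler_op_eq_powr: "euler_op f = (\<lambda>x. x powr 1 * pos_deriv f x)"
  by (auto simp: euler_op_def fun_eq_iff pos_deriv_def)

lemma euler_op_schwartz: "f \<in> schwartz_pos \<Longrightarrow> euler_op f \<in> schwartz_pos"
  unfolding euler_op_eq_powr by (intro schwartz_pos_powr_mult schwartz_pos_pos_deriv)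

text \<open>
  Integration by parts: \<open>x\<^sup>s f\<close> vanishes at both ends of the half-line, so its derivative
  \<open>s x\<^bsup>s-1\<^esup> f + x\<^sup>s f'\<close> has integral 0.
\<close>

lemma mellin_euler_op:
  assumes f: "f \<in> schwartz_pos"
  shows "mellin s (euler_op f) = - s * mellin s f"
proof -
  let ?F = "\<lambda>x. x powr s * f x" and ?F' = "\<lambda>x. s * (x powr (s - 1) * f x) + x powr s * pos_deriv f x"
  have f': "pos_deriv f \<in> schwartz_pos" and F: "?F \<in> schwartz_pos"
    by (rule schwartz_pos_pos_deriv[OF f], rule schwartz_pos_powr_mult[OF f])
  have F': "?F' \<in> schwartz_pos"
    by (intro schwartz_pos_add schwartz_pos_cmult schwartz_pos_powr_mult f f')
  have "integral\<^sup>L lborel ?F' = 0"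
  proof (rule integral_derivative_eq_0)
    fix x :: real
    assume x: "0 < x"
    have "((\<lambda>x. x powr s) has_real_derivative s * x powr (s - 1)) (at x)"
      using x by (auto intro!: derivative_eq_intros)
    from DERIV_mult[OF this schwartz_pos_DERIV[OF f x]]
    show "(?F has_real_derivative ?F' x) (at x)"
      by (simp add: mult_ac)
    show "isCont ?F' x" by (rule schwartz_pos_isCont[OF F' x])
  next
    show "?F' x = 0" if "x \<le> 0" for x
      using that by (rule schwartz_pos_zero[OF F'])
    show "integrable lborel ?F'"
      by (rule schwartz_pos_integrable[OF F'])
    show "(?F \<longlongrightarrow> 0) (at_right 0)" "(?F \<longlongrightarrow> 0) at_top"
      by (rule rapidly_decreasing_tendsto_0[OF schwartz_pos_rapidly_decreasing[OF F]])+
  qed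
  moreover have "x powr s * pos_deriv f x = x powr (s - 1) * euler_op f x" for x
    by (simp only: euler_op_eq_powr mult.assoc[symmetric] powr_add[symmetric]) simp
  ultimately show ?thesis
    using mellin_integrable[OF f, of s] mellin_integrable[OF euler_op_schwartz[OF f], of s]
    by (simp add: mellin_def)
qed

text \<open>
  The two integrands differ by the derivative of \<open>f (x / y) g(y)\<close> with respect to \<open>y\<close>, and this
  function vanishes at both ends because \<open>f\<close> is bounded and \<open>g\<close> decays.
\<close>

lemma mellin_conv_euler_op:
  assumes f: "f \<in> schwartz_pos" and g: "g \<in> schwartz_pos"
  shows "euler_op f \<star> g = f \<star> euler_op g"
proof
  fix x
  have f': "pos_deriv f \<in> schwartz_pos" and g': "pos_deriv g \<in> schwartz_pos"
    by (rule schwartz_pos_pos_deriv[OF f], rule schwartz_pos_pos_deriv[OF g])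
  let ?A = "\<lambda>y. euler_op f (x / y) * (y powr -1 * g y)" and ?B = "\<lambda>y. f (x / y) * (y powr -1 * euler_op g y)"
  have A: "integrable lborel ?A" and B: "integrable lborel ?B"
    by (intro dilation_average_integrable euler_op_schwartz schwartz_pos_powr_mult f g)+
  show "(euler_op f \<star> g) x = (f \<star> euler_op g) x"
  proof (cases "0 < x")
    case x: True
    obtain C where C: "\<And>u. \<bar>f u\<bar> \<le> C"
      using rapidly_decreasing_bounded[OF schwartz_pos_rapidly_decreasing[OF f]] by blast
    have lim: "((\<lambda>y. f (x / y) * g y) \<longlongrightarrow> 0) F" if "(g \<longlongrightarrow> 0) F" for F
    proof (rule Lim_null_comparison)
      show "\<forall>\<^sub>F y in F. norm (f (x / y) * g y) \<le> C * \<bar>g y\<bar>"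
        using C by (simp add: abs_mult mult_right_mono)
      show "((\<lambda>y. C * \<bar>g y\<bar>) \<longlongrightarrow> 0) F"
        using that by (auto intro!: tendsto_eq_intros)
    qed
    have "(\<integral>y. ?B y - ?A y \<partial>lborel) = 0"
    proof (rule integral_derivative_eq_0[where F="\<lambda>y. f (x / y) * g y"])
      fix y :: real
      assume y: "0 < y"
      have "((\<lambda>y. f (x / y)) has_real_derivative pos_deriv f (x / y) * (- x / y\<^sup>2)) (at y)"
        using schwartz_pos_DERIV[OF f, of "x / y"] x y
        by (intro DERIV_chain2[where g="\<lambda>y. x / y"])
          (auto intro!: derivative_eq_intros simp: power2_eq_square)
      from DERIV_mult[OF this schwartz_pos_DERIV[OF g y]]
      show "((\<lambda>y. f (x / y) * g y) has_real_derivative ?B y - ?A y) (at y)"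
      proof (rule DERIV_cong)
        have "y powr -1 = 1 / y"
          using y by (simp add: powr_minus divide_inverse)
        then show "pos_deriv f (x / y) * (- x / y\<^sup>2) * g y + pos_deriv g y * f (x / y) = ?B y - ?A y"
          unfolding euler_op_def using y by (simp add: power2_eq_square)
      qed
      have cont: "isCont (\<lambda>y. h (x / y) * l y) y" if h: "h \<in> schwartz_pos" and l: "l \<in> schwartz_pos" for h l
      proof (rule continuous_mult[OF _ schwartz_pos_isCont[OF l y]])
        have "isCont (\<lambda>y. x / y) y"
          using y by (intro continuous_intros) auto
        moreover have "isCont h (x / y)"
          using x y by (intro schwartz_pos_isCont[OF h]) simp
        ultimately show "isCont (\<lambda>y. h (x / y)) y"
          by (rule isCont_o2)
      qed
      show "isCont (\<lambda>y. ?B y - ?A y) y"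
        by (intro continuous_diff cont schwartz_pos_powr_mult euler_op_schwartz f g)
    next
      show "?B y - ?A y = 0" if "y \<le> 0" for y
        using that schwartz_pos_zero[OF g] schwartz_pos_zero[OF euler_op_schwartz[OF g]] by simp
      show "integrable lborel (\<lambda>y. ?B y - ?A y)"
        using A B by simp
      show "((\<lambda>y. f (x / y) * g y) \<longlongrightarrow> 0) (at_right 0)" "((\<lambda>y. f (x / y) * g y) \<longlongrightarrow> 0) at_top"
        by (rule lim[OF rapidly_decreasing_tendsto_0(1)[OF schwartz_pos_rapidly_decreasing[OF g]]],
          rule lim[OF rapidly_decreasing_tendsto_0(2)[OF schwartz_pos_rapidly_decreasing[OF g]]])
    qed
    moreover have "(\<integral>y. ?B y - ?A y \<partial>lborel) = integral\<^sup>L lborel ?B - integral\<^sup>L lborel ?A"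
      by (rule Bochner_Integration.integral_diff[OF B A])
    ultimately show ?thesis
      by (simp only: mellin_conv_eq_dilation_average[OF euler_op_schwartz[OF f] g]
        mellin_conv_eq_dilation_average[OF f euler_op_schwartz[OF g]] dilation_average_def)
  qed (simp add: mellin_conv_def)
qed

section \<open>The kernel of the Mellin functional\<close>

lemma schwartz_posI_primitive:
  assumes "rapidly_decreasing F" "f \<in> schwartz_pos"
    and "\<And>x. 0 < x \<Longrightarrow> (F has_real_derivative f x) (at x)"
  shows "F \<in> schwartz_pos"
proof -
  have "pos_deriv F = f"
    using assms(2,3) by (intro pos_deriv_eqI) (auto simp: schwartz_pos_zero)
  moreover have "F differentiable (at x)" if "0 < x" for x
    using assms(3)[OF that] by (auto simp: real_differentiable_def)
  ultimately have "schwartz_upto n F" for n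
    using assms(1,2) by (cases n) (auto simp: schwartz_pos_iff)
  then show ?thesis by (simp add: schwartz_pos_iff)
qed

text \<open>
  The primitive is \<open>\<integral>\<^sub>0\<^sup>x f\<close>, which is also \<open>- \<integral>\<^sub>x\<^sup>\<infinity> f\<close> because the total integral is 0. For \<open>x\<^sup>a F\<close> with
  \<open>a \<le> 0\<close> the first form is used, with \<open>a > 0\<close> the second: in both cases \<open>x\<^sup>a \<le> y\<^sup>a\<close> on the domain of
  integration, so the integral of \<open>y\<^sup>a |f(y)|\<close> is a bound.
\<close>

lemma schwartz_primitive:
  assumes f: "f \<in> schwartz_pos" and 0: "integral\<^sup>L lborel f = 0"
  obtains F where "F \<in> schwartz_pos" "pos_deriv F = f"
proof -
  define F where "F = (\<lambda>x. \<integral>y. indicator {..x} y * f y \<partial>lborel)"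
  note f_int = schwartz_pos_integrable[OF f]
  have cut: "integrable lborel (\<lambda>y. indicator A y * f y)" if "A \<in> sets lborel" for A
    using integrable_mult_indicator[OF that f_int] by simp
  have F_upper: "F x = - (\<integral>y. indicator {x<..} y * f y \<partial>lborel)" for x
  proof -
    have "F x + (\<integral>y. indicator {x<..} y * f y \<partial>lborel) =
        (\<integral>y. indicator {..x} y * f y + indicator {x<..} y * f y \<partial>lborel)"
      unfolding F_def by (intro Bochner_Integration.integral_add[symmetric] cut) auto
    also have "\<dots> = integral\<^sup>L lborel f"
      by (intro Bochner_Integration.integral_cong) (auto simp: indicator_def)
    finally show ?thesis using 0 by simp
  qed
  have F_zero: "F x = 0" if "x \<le> 0" for x
  proof -
    have "indicator {..x} y * f y = 0" for y
      using that schwartz_pos_zero[OF f, of y] by (auto simp: indicator_def)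
    then show ?thesis by (simp only: F_def) simp
  qed
  have F_rapid: "rapidly_decreasing F"
    unfolding rapidly_decreasing_def
  proof (intro conjI allI impI F_zero)
    fix a
    have bound: "\<bar>x powr a * (\<integral>y. indicator A y * f y \<partial>lborel)\<bar> \<le> (\<integral>y. \<bar>y powr a * f y\<bar> \<partial>lborel)"
      if A: "A \<in> sets lborel" and le: "\<And>y. y \<in> A \<Longrightarrow> 0 < y \<Longrightarrow> x powr a \<le> y powr a" for A x
    proof -
      have "\<bar>x powr a * (\<integral>y. indicator A y * f y \<partial>lborel)\<bar> =
          \<bar>\<integral>y. x powr a * (indicator A y * f y) \<partial>lborel\<bar>"
        by simp
      also have "\<dots> \<le> (\<integral>y. \<bar>y powr a * f y\<bar> \<partial>lborel)"
      proof (rule order_trans[OF integral_abs_bound integral_mono])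
        show "integrable lborel (\<lambda>y. \<bar>x powr a * (indicator A y * f y)\<bar>)"
          using cut[OF A] by (intro integrable_abs integrable_mult_right)
        show "integrable lborel (\<lambda>y. \<bar>y powr a * f y\<bar>)"
          by (intro integrable_abs schwartz_pos_integrable schwartz_pos_powr_mult f)
        show "\<bar>x powr a * (indicator A y * f y)\<bar> \<le> \<bar>y powr a * f y\<bar>" for y
          using le[of y] schwartz_pos_zero[OF f, of y]
          by (cases "0 < y") (auto simp: abs_mult indicator_def intro!: mult_right_mono)
      qed
      finally show ?thesis .
    qed
    have "\<bar>x powr a * F x\<bar> \<le> (\<integral>y. \<bar>y powr a * f y\<bar> \<partial>lborel)" for x
    proof (cases "0 < x")
      case True
      show ?thesis
      proof (cases "a \<le> 0")
        case True
        then show ?thesis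
          using \<open>0 < x\<close> unfolding F_def by (intro bound) (auto intro: powr_mono2')
      next
        case False
        then have "\<bar>x powr a * (\<integral>y. indicator {x<..} y * f y \<partial>lborel)\<bar> \<le>
            (\<integral>y. \<bar>y powr a * f y\<bar> \<partial>lborel)"
          using \<open>0 < x\<close> by (intro bound) (auto intro: powr_mono2)
        then show ?thesis by (simp add: F_upper)
      qed
    qed (simp add: F_zero integral_nonneg)
    then show "\<exists>C. \<forall>x. \<bar>x powr a * F x\<bar> \<le> C" by blast
  qed
  have F_deriv: "(F has_real_derivative f x) (at x)" if x: "0 < x" for x
  proof -
    \<comment> \<open>The interval starts at the origin, where \<open>f\<close> is continuous because it decays there; it
      extends beyond \<open>x\<close> so that \<open>x\<close> is an interior point.\<close>
    have cont: "continuous_on {0..x + 1} f"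
      unfolding continuous_on_eq_continuous_within
    proof
      fix t
      assume t: "t \<in> {0..x + 1}"
      show "continuous (at t within {0..x + 1}) f"
      proof (cases "t = 0")
        case True
        then show ?thesis
          using x rapidly_decreasing_tendsto_0(1)[OF schwartz_pos_rapidly_decreasing[OF f]]
          by (simp add: continuous_within at_within_Icc_at_right schwartz_pos_zero[OF f])
      next
        case False
        then have "isCont f t"
          using t by (intro schwartz_pos_isCont[OF f]) simp
        then show ?thesis
          by (rule continuous_at_imp_continuous_at_within)
      qed
    qed
    have eq: "integral {0..u} f = F u" for u
    proof -
      have "set_integrable lborel {0..u} f"
        using cut[of "{0..u}"] by (simp add: set_integrable_def)
      from set_borel_integral_eq_integral(2)[OF this]
      have "integral {0..u} f = (\<integral>y. indicator {0..u} y * f y \<partial>lborel)"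
        by (simp add: set_lebesgue_integral_def)
      also have "\<dots> = F u"
        unfolding F_def using schwartz_pos_zero[OF f]
        by (intro Bochner_Integration.integral_cong) (auto simp: indicator_def)
      finally show ?thesis .
    qed
    have "((\<lambda>u. integral {0..u} f) has_real_derivative f x) (at x within {0..x + 1})"
      using x by (intro integral_has_real_derivative[OF cont]) auto
    then show ?thesis
      using x at_within_interior[of x "{0..x + 1}"] by (simp add: eq)
  qed
  show thesis
  proof (rule that)
    show "F \<in> schwartz_pos"
      using F_rapid f F_deriv by (rule schwartz_posI_primitive)
    show "pos_deriv F = f"
      using F_deriv schwartz_pos_zero[OF f] by (intro pos_deriv_eqI)
  qed
qed

text \<open>
  Multiplication by \<open>x\<^sup>s\<close> turns \<open>D u + s u = h\<close> into \<open>(x\<^sup>s u)' = x\<^bsup>s-1\<^esup> h\<close>, and the hypothesis says that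
  the right-hand side has integral 0.
\<close>

lemma mellin_kernel:
  assumes h: "h \<in> schwartz_pos" and "mellin s h = 0"
  obtains u where "u \<in> schwartz_pos" "h = (\<lambda>x. euler_op u x + s * u x)"
proof -
  let ?h = "\<lambda>x. x powr (s - 1) * h x"
  obtain F where F: "F \<in> schwartz_pos" "pos_deriv F = ?h"
    using schwartz_primitive[OF schwartz_pos_powr_mult[OF h]] assms(2) unfolding mellin_def by blast
  let ?u = "\<lambda>x. x powr - s * F x"
  have u: "?u \<in> schwartz_pos"
    by (intro schwartz_pos_powr_mult F)
  have "h x = euler_op ?u x + s * ?u x" for x
  proof (cases "0 < x")
    case x: True
    have "((\<lambda>x. x powr - s) has_real_derivative - s * x powr (- s - 1)) (at x)"
      using x by (auto intro!: derivative_eq_intros)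
    from DERIV_mult[OF this schwartz_pos_DERIV[OF F(1) x]]
    have "pos_deriv ?u x = - s * x powr (- s - 1) * F x + ?h x * x powr - s"
      using x by (simp add: pos_deriv_def DERIV_imp_deriv F(2))
    moreover have "x * x powr (- s - 1) = x powr - s"
      using x by (simp add: powr_diff)
    moreover have "x * (x powr (s - 1) * x powr - s) = 1"
      using x by (simp add: powr_diff powr_minus)
    ultimately show ?thesis
      unfolding euler_op_def by (simp add: algebra_simps) algebra
  next
    case False
    then show ?thesis
      by (simp add: schwartz_pos_zero[OF h] schwartz_pos_zero[OF F(1)] euler_op_def pos_deriv_def)
  qed
  with u show thesis using that by blast
qed

section \<open>A positive Schwartz function\<close>

definition bump :: "real \<Rightarrow> real" where
  "bump x = (if 0 < x then exp (- x - inverse x) else 0)"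

lemma exp_minus_powr_bound:
  assumes "0 \<le> a"
  shows "\<exists>C. \<forall>x>0. x powr a * exp (- x) \<le> (C::real)"
proof -
  have "x powr a * exp (- x) \<le> 1 + fact (nat \<lceil>a\<rceil>)" if x: "0 < x" for x :: real
  proof (cases "x \<le> 1")
    case True
    have "x powr a \<le> 1" using True x assms by (simp add: powr_le1)
    moreover have "exp (- x) \<le> 1" using x by simp
    ultimately have "x powr a * exp (- x) \<le> 1 * 1" by (intro mult_mono) auto
    then show ?thesis by (simp add: add_increasing2)
  next
    case False
    let ?n = "nat \<lceil>a\<rceil>"
    have "x powr a \<le> x powr real ?n"
      using False assms by (intro powr_mono) (auto simp: real_nat_ceiling_ge)
    also have "\<dots> = x ^ ?n" using x by (simp add: powr_realpow)
    also have "\<dots> \<le> fact ?n * exp x"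
    proof -
      \<comment> \<open>a single term of the exponential series\<close>
      have "(\<Sum>k\<in>{?n}. x ^ k /\<^sub>R fact k) \<le> exp x"
        unfolding exp_def using x summable_exp_generic[of x]
        by (intro sum_le_suminf) auto
      then show ?thesis by (simp add: field_simps)
    qed
    finally have "x powr a * exp (- x) \<le> fact ?n"
      by (simp add: exp_minus field_simps)
    then show ?thesis by simp
  qed
  then show ?thesis by blast
qed

text \<open>
  A positive power is absorbed by \<open>exp (- x)\<close>, a negative one by \<open>exp (- 1/x)\<close>; the substitution
  \<open>x \<mapsto> 1/x\<close> gives the second bound from the first.
\<close>

lemma rapidly_decreasing_bump: "rapidly_decreasing bump"
  unfolding rapidly_decreasing_def
proof (intro conjI allI impI)
  fix a :: real
  obtain C where C: "\<And>x. 0 < x \<Longrightarrow> x powr \<bar>a\<bar> * exp (- x) \<le> C"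
    using exp_minus_powr_bound[of "\<bar>a\<bar>"] by auto
  have "\<bar>x powr a * bump x\<bar> \<le> max C 0" for x
  proof (cases "0 < x")
    case x: True
    have *: "exp (- x - inverse x) \<le> exp (- x)" "exp (- x - inverse x) \<le> exp (- inverse x)"
      using x by auto
    have "x powr a * exp (- x - inverse x) \<le> C"
    proof (cases "0 \<le> a")
      case True
      then show ?thesis
        using C[OF x] mult_left_mono[OF *(1), of "x powr a"] by simp
    next
      case False
      then have "x powr a = inverse x powr \<bar>a\<bar>"
        using x by (simp add: powr_minus inverse_powr)
      then show ?thesis
        using order_trans[OF mult_left_mono[OF *(2) powr_ge_zero] C[of "inverse x"]] x by simp
    qed
    then show ?thesis using x by (simp add: bump_def)
  qed (simp add: bump_def)
  then show "\<exists>C. \<forall>x. \<bar>x powr a * bump x\<bar> \<le> C" by blast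
qed (simp add: bump_def)

lemma bump_DERIV:
  assumes "0 < x"
  shows "(bump has_real_derivative x powr -2 * bump x + (-1) * bump x) (at x)"
proof -
  have "((\<lambda>x. exp (- x - inverse x)) has_real_derivative x powr -2 * bump x + (-1) * bump x) (at x)"
    using assms
    by (auto intro!: derivative_eq_intros simp: bump_def powr_minus powr_numeral power2_eq_square algebra_simps)
  moreover have "\<forall>\<^sub>F y in nhds x. exp (- y - inverse y) = bump y"
    using assms eventually_nhds_in_open[of "{0<..}" x]
    by (auto elim!: eventually_mono simp: bump_def)
  ultimately show ?thesis
    by (rule iffD1[OF DERIV_cong_ev[OF refl _ refl], rotated])
qed

text \<open>
  The derivative is \<open>(x\<^bsup>-2\<^esup> - 1)\<close> times the function itself, so control of \<open>n\<close> derivatives yields control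
  of \<open>n + 1\<close>.
\<close>

lemma bump_schwartz: "bump \<in> schwartz_pos"
proof -
  have diff: "\<forall>x>0. bump differentiable (at x)"
    using bump_DERIV by (auto simp: real_differentiable_def)
  have eq: "pos_deriv bump = (\<lambda>x. x powr -2 * bump x + (-1) * bump x)"
    by (intro pos_deriv_eqI bump_DERIV) (auto simp: bump_def)
  have "schwartz_upto n bump" for n
  proof (induction n)
    case 0
    show ?case using rapidly_decreasing_bump diff by simp
  next
    case (Suc n)
    have "schwartz_upto n (pos_deriv bump)"
      unfolding eq by (rule schwartz_upto_add[OF schwartz_upto_powr_mult[OF Suc] schwartz_upto_cmult[OF Suc]])
    then show ?case using rapidly_decreasing_bump diff by simp
  qed
  then show ?thesis by (simp add: schwartz_pos_iff)
qed

lemma mellin_bump_nonzero: "mellin s bump \<noteq> 0"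
proof
  assume "mellin s bump = 0"
  then have "AE x in lborel. x powr (s - 1) * bump x = 0"
    unfolding mellin_def using mellin_integrable[OF bump_schwartz, of s]
    by (subst (asm) integral_nonneg_eq_0_iff_AE) (auto simp: bump_def)
  then have "AE x in lborel. x \<notin> {0::real<..<1}"
    by (rule AE_mp) (auto simp: bump_def)
  then have "{0::real<..<1} \<in> null_sets lborel"
    by (subst AE_iff_null_sets) auto
  then show False
    by (simp add: null_sets_def)
qed

section \<open>The structure space\<close>

text \<open>
  The continuity estimate: two of the seminorms of order 0 control the Mellin functional, whose
  exponent \<open>s - 1\<close> need not be an integer.
\<close>

lemma mellin_bound:
  obtains C k l where "0 < C"
    "\<And>h. h \<in> schwartz_pos \<Longrightarrow> \<bar>mellin s h\<bar> \<le> C * (schwartz_seminorm k 0 h + schwartz_seminorm l 0 h)"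
proof -
  let ?k = "\<lfloor>s - 1\<rfloor>" and ?l = "\<lceil>s - 1 + 2\<rceil>"
  let ?w = "\<lambda>x::real. inverse (1 + x\<^sup>2)"
  define I where "I = integral\<^sup>L lborel ?w"
  have "0 \<le> I" unfolding I_def by (intro Bochner_Integration.integral_nonneg) simp
  have "\<bar>mellin s h\<bar> \<le> (2 * I + 1) * (schwartz_seminorm ?k 0 h + schwartz_seminorm ?l 0 h)"
    if h: "h \<in> schwartz_pos" for h
  proof -
    let ?N = "schwartz_seminorm ?k 0 h + schwartz_seminorm ?l 0 h"
    have semi: "\<bar>x powi k * h x\<bar> \<le> schwartz_seminorm k 0 h" if "0 < x" for x k
    proof -
      have "bdd_above ((\<lambda>x. \<bar>x powi k * h x\<bar>) ` {0<..})"
        using schwartz_pos_rapidly_decreasing[OF h] by (simp add: rapidly_decreasing_iff_powi)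
      from cSUP_upper[OF _ this, of x] show ?thesis
        using that by (simp add: schwartz_seminorm_def)
    qed
    have N: "0 \<le> ?N"
      using semi[of 1 ?k] semi[of 1 ?l] by simp
    have pt: "\<bar>x powr (s - 1) * h x\<bar> \<le> 2 * ?N * ?w x" for x
    proof (cases "0 < x")
      case True
      have "\<bar>x powr (s - 1) * h x\<bar> \<le> 2 * (x powi ?k + x powi ?l) * ?w x * \<bar>h x\<bar>"
        using powr_le_sum_powi[OF True, of "s - 1"] by (simp add: abs_mult mult_right_mono)
      also have "\<dots> = 2 * (\<bar>x powi ?k * h x\<bar> + \<bar>x powi ?l * h x\<bar>) * ?w x"
        using True by (simp add: abs_mult algebra_simps)
      also have "\<dots> \<le> 2 * ?N * ?w x"
        using semi[OF True] by (intro mult_right_mono mult_left_mono add_mono) auto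
      finally show ?thesis .
    qed (use N schwartz_pos_zero[OF h] in simp)
    have "\<bar>mellin s h\<bar> \<le> (\<integral>x. 2 * ?N * ?w x \<partial>lborel)"
      unfolding mellin_def
      using mellin_integrable[OF h, of s] pt integrable_inverse_1_plus_square_lborel
      by (intro order_trans[OF integral_abs_bound integral_mono]) auto
    also have "\<dots> = 2 * I * ?N"
      by (simp add: I_def)
    also have "\<dots> \<le> (2 * I + 1) * ?N"
      using N by (intro mult_right_mono) auto
    finally show ?thesis .
  qed
  \<comment> \<open>The summand 1 only makes the constant visibly positive.\<close>
  then show thesis
    using that[of "2 * I + 1" ?k ?l] \<open>0 \<le> I\<close> by simp
qed

lemma openin_schwartz_ball:
  assumes "f \<in> schwartz_pos" "0 < e"
  shows "openin schwartz_topology {g \<in> schwartz_pos. schwartz_seminorm k n (\<lambda>x. g x - f x) < e}"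
  unfolding schwartz_topology_def
  by (rule topology_generated_by_Basis, rule CollectI,
      rule exI[of _ f], rule exI[of _ k], rule exI[of _ n], rule exI[of _ e])
    (simp add: assms)

lemma topspace_schwartz_topology: "topspace schwartz_topology = schwartz_pos"
proof
  show "topspace schwartz_topology \<subseteq> schwartz_pos"
    unfolding schwartz_topology_def topology_generated_by_topspace
    by (rule Union_least) auto
  show "schwartz_pos \<subseteq> topspace schwartz_topology"
  proof
    fix f
    assume f: "f \<in> schwartz_pos"
    then have "f \<in> {g \<in> schwartz_pos. schwartz_seminorm 0 0 (\<lambda>x. g x - f x) < 1}"
      by (simp add: schwartz_seminorm_def)
    then show "f \<in> topspace schwartz_topology"
      using openin_subset[OF openin_schwartz_ball[OF f, of 1 0 0]] by auto
  qed
qed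

lemma mellin_functional_continuous:
  "continuous_map schwartz_topology euclideanreal (mellin_functional s)"
proof -
  obtain C k l where C: "0 < C"
    "\<And>h. h \<in> schwartz_pos \<Longrightarrow> \<bar>mellin s h\<bar> \<le> C * (schwartz_seminorm k 0 h + schwartz_seminorm l 0 h)"
    using mellin_bound[of s] by blast
  show ?thesis
    unfolding continuous_map topspace_schwartz_topology
  proof (intro conjI allI impI)
    fix U :: "real set"
    assume "openin euclideanreal U"
    then have "open U" by simp
    show "openin schwartz_topology {f \<in> schwartz_pos. mellin_functional s f \<in> U}"
    proof (subst openin_subopen, intro ballI)
      fix f
      assume "f \<in> {f \<in> schwartz_pos. mellin_functional s f \<in> U}"
      then have f: "f \<in> schwartz_pos" and "mellin s f \<in> U"
        by (auto simp: mellin_functional_eq)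
      then obtain e where e: "0 < e" "\<And>y. dist y (mellin s f) < e \<Longrightarrow> y \<in> U"
        using \<open>open U\<close> by (auto simp: open_dist)
      define d where "d = e / (2 * C)"
      have d: "0 < d" using e C by (simp add: d_def)
      let ?B = "\<lambda>k. {g \<in> schwartz_pos. schwartz_seminorm k 0 (\<lambda>x. g x - f x) < d}"
      have "openin schwartz_topology (?B k \<inter> ?B l)"
        by (intro openin_Int openin_schwartz_ball f d)
      moreover have "f \<in> ?B k \<inter> ?B l"
        using f d by (simp add: schwartz_seminorm_def)
      moreover have "g \<in> schwartz_pos \<and> mellin_functional s g \<in> U" if g: "g \<in> ?B k \<inter> ?B l" for g
      proof -
        have gS: "g \<in> schwartz_pos" using g by simp
        have "\<bar>mellin s g - mellin s f\<bar> = \<bar>mellin s (\<lambda>x. g x - f x)\<bar>"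
          using mellin_diff[OF gS f] by simp
        also have "\<dots> \<le> C * (schwartz_seminorm k 0 (\<lambda>x. g x - f x) + schwartz_seminorm l 0 (\<lambda>x. g x - f x))"
          by (intro C schwartz_pos_diff gS f)
        also have "\<dots> < C * (d + d)"
          using g C(1) by (intro mult_strict_left_mono add_strict_mono) auto
        also have "\<dots> = e"
          using C(1) by (simp add: d_def)
        finally show ?thesis
          using gS by (simp add: mellin_functional_eq e(2) dist_real_def)
      qed
      ultimately show "\<exists>T. openin schwartz_topology T \<and> f \<in> T \<and>
          T \<subseteq> {f \<in> schwartz_pos. mellin_functional s f \<in> U}"
        by (intro exI[of _ "?B k \<inter> ?B l"]) blast
    qed
  qed auto
qed

lemma mellin_functional_in_structure_space: "mellin_functional s \<in> structure_space"
  unfolding structure_space_def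
  using bump_schwartz mellin_bump_nonzero[of s] mellin_functional_continuous[of s]
  by (auto simp: mellin_functional_eq schwartz_pos_add schwartz_pos_cmult mellin_conv_schwartz
      mellin_add mellin_cmult mellin_mellin_conv intro!: bexI[of _ bump])
    (simp add: mellin_functional_def)

text \<open>
  The functional determines its parameter as the factor by which the Euler operator acts.
\<close>

lemma mellin_functional_inj: "mellin_functional s = mellin_functional t \<Longrightarrow> s = t"
proof -
  assume eq: "mellin_functional s = mellin_functional t"
  have eq: "mellin s f = mellin t f" if "f \<in> schwartz_pos" for f
    using that eq by (metis mellin_functional_eq)
  have "- s * mellin s bump = - t * mellin s bump"
    using eq[OF bump_schwartz] eq[OF euler_op_schwartz[OF bump_schwartz]]
      mellin_euler_op[OF bump_schwartz] by metis
  then show "s = t" using mellin_bump_nonzero[of s] by simp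
qed

text \<open>
  The factor \<open>- s\<close> by which the Euler operator acts under \<open>m\<close> determines the kernel of \<open>m\<close>, hence \<open>m\<close>
  up to a scalar, and multiplicativity fixes the scalar.
\<close>

lemma structure_space_eq_mellin_functional:
  assumes "m \<in> structure_space"
  obtains s where "m = mellin_functional s"
proof -
  have ext: "m \<in> extensional schwartz_pos"
    and add: "\<And>f g. f \<in> schwartz_pos \<Longrightarrow> g \<in> schwartz_pos \<Longrightarrow> m (\<lambda>x. f x + g x) = m f + m g"
    and cmult: "\<And>c f. f \<in> schwartz_pos \<Longrightarrow> m (\<lambda>x. c * f x) = c * m f"
    and conv: "\<And>f g. f \<in> schwartz_pos \<Longrightarrow> g \<in> schwartz_pos \<Longrightarrow> m (f \<star> g) = m f * m g"
    using assms unfolding structure_space_def by blast+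
  obtain g where g: "g \<in> schwartz_pos" "m g \<noteq> 0"
    using assms unfolding structure_space_def by blast
  define s where "s = - m (euler_op g) / m g"
  have euler: "m (euler_op f) = - s * m f" if f: "f \<in> schwartz_pos" for f
  proof -
    have "m (euler_op f) * m g = m f * m (euler_op g)"
      using conv[OF euler_op_schwartz[OF f] g(1)] conv[OF f euler_op_schwartz[OF g(1)]]
        mellin_conv_euler_op[OF f g(1)] by simp
    then show ?thesis using g(2) by (simp add: s_def field_simps)
  qed
  have kernel: "m h = 0" if h: "h \<in> schwartz_pos" "mellin s h = 0" for h
  proof -
    obtain u where u: "u \<in> schwartz_pos" "h = (\<lambda>x. euler_op u x + s * u x)"
      using mellin_kernel[OF h] by blast
    have "m h = m (euler_op u) + s * m u"
      unfolding u(2) by (simp add: add cmult euler_op_schwartz schwartz_pos_cmult u(1))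
    then show ?thesis using euler[OF u(1)] by simp
  qed
  define c where "c = m bump / mellin s bump"
  have m_eq: "m f = c * mellin s f" if f: "f \<in> schwartz_pos" for f
  proof -
    \<comment> \<open>Subtracting the right multiple of the bump function moves \<open>f\<close> into the kernel.\<close>
    define r where "r = mellin s f / mellin s bump"
    let ?h = "\<lambda>x. f x + (- r) * bump x"
    have r: "(\<lambda>x. (- r) * bump x) \<in> schwartz_pos"
      by (intro schwartz_pos_cmult bump_schwartz)
    have "mellin s ?h = mellin s f + (- r) * mellin s bump"
      by (simp only: mellin_add[OF f r] mellin_cmult)
    then have "mellin s ?h = 0"
      using mellin_bump_nonzero[of s] by (simp add: r_def)
    then have "m ?h = 0"
      by (intro kernel schwartz_pos_add f r)
    moreover have "m ?h = m f + (- r) * m bump"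
      by (simp only: add[OF f r] cmult[OF bump_schwartz])
    ultimately show ?thesis by (simp add: r_def c_def)
  qed
  \<comment> \<open>Evaluating \<open>m (g \<star> g)\<close> in two ways gives \<open>c = c\<^sup>2\<close>.\<close>
  have "c * (mellin s g * mellin s g) = (c * mellin s g) * (c * mellin s g)"
    using conv[OF g(1) g(1)] m_eq[OF g(1)] m_eq[OF mellin_conv_schwartz[OF g(1) g(1)]]
      mellin_mellin_conv[OF g(1) g(1), of s] by simp
  then have "c = 1"
    using g(2) m_eq[OF g(1)] by simp
  have "m = mellin_functional s"
  proof (rule extensionalityI[OF ext])
    show "mellin_functional s \<in> extensional schwartz_pos"
      by (simp add: mellin_functional_def)
  qed (simp add: m_eq \<open>c = 1\<close> mellin_functional_eq)
  then show thesis using that by blast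
qed

theorem theorem14:
  "(\<forall>s. mellin_functional s \<in> structure_space) \<and>
   (\<forall>m\<in>structure_space. \<exists>!s. m = mellin_functional s)"
  using mellin_functional_in_structure_space structure_space_eq_mellin_functional
    mellin_functional_inj by metis

end
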